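(* Let $n$ be a positive integer and let $X\in\mathfrak{o}_{2n}$ be written in block form $$X=\begin{bmatrix} a&b\\ c&-J_n\,{}^ta\,J_n\end{bmatrix}$$ with $a,b,c$ all of size $n\times n$; for $i,j\in[n]$ set $a_{i,j}=X_{i,j}$, $b_{i,j}=X_{i,-j}$, $c_{i,j}=X_{-j,i}$, where $-i$ stands for the index $2n+1-i$. Then $$\operatorname{Pf}(X)=\sum_{k=0}^{\lfloor n/2\rfloor}\ \sum_{\substack{I,J\subset[n]\\ |I|=|J|=2k}}\operatorname{sgn}(\bar I,I)\,\operatorname{sgn}(\bar J,J)\,\det(a^{\bar I}_{\bar J})\,\operatorname{Pf}(b_I)\,\operatorname{Pf}(c_J),$$ where $\bar I,\bar J$ are the complements of $I,J$ in $[n]$.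
   Context: Notation. $[m]=\{1,\dots,m\}$. Row and column indices of $2n\times2n$ matrices lie in $[2n]$, and $-i$ stands for $2n+1-i$. $J_N$ is the $N\times N$ matrix with $1$'s on the anti-diagonal and $0$'s elsewhere; $\mathfrak{o}_{2n}=\{X\in\mathrm{Mat}_{2n}(\mathbb{C}):{}^tXJ_{2n}+J_{2n}X=0\}$. For $X\in\mathfrak o_{2n}$ the matrix $XJ_{2n}$, with $(i,j)$ entry $X_{i,-j}$, is alternating, and $\operatorname{Pf}(X)$ means the (usual) Pfaffian of $XJ_{2n}$. The arrays $b_{i,j}$ and $c_{i,j}$ satisfy $b_{j,i}=-b_{i,j}$, $c_{j,i}=-c_{i,j}$. For $I=\{i_1<\dots<i_{2k}\}\subset[n]$, $\operatorname{Pf}(b_I)$ is the usual Pfaffian of the alternating matrix $(b_{i_s,i_t})_{s,t\in[2k]}$, and similarly $\operatorname{Pf}(c_J)$ is that of $(c_{j_s,j_t})_{s,t}$. $a^{\bar I}_{\bar J}=(a_{i,j})_{i\in\bar I,j\in\bar J}$ with rows and columns in increasing order. Empty Pfaffians and determinants equal $1$. The Pfaffian of an alternating complex $2m\times2m$ matrix $A$ is $\operatorname{Pf}(A)=\frac{1}{2^m m!}\sum_{\sigma\in\mathfrak S_{2m}}\operatorname{sgn}(\sigma)A_{\sigma(1),\sigma(2)}\cdots A_{\sigma(2m-1),\sigma(2m)}$. Signs: if $[n]=\bar I\sqcup I$, $\bar I=\{\bar i_1<\dots<\bar i_h\}$, $I=\{i_1<\dots<i_s\}$, then $\operatorname{sgn}(\bar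 I,I)$ is the signature of the permutation sending $1,\dots,n$ to $\bar i_1,\dots,\bar i_h,i_1,\dots,i_s$. *)

theory Defs
  imports
    "HOL-Combinatorics.Permutations"
    "Jordan_Normal_Form.Determinant"
    "Jordan_Normal_Form.DL_Submatrix"
    Complex_Main
begin

text \<open>
  All indices are shifted to start at 0, as usual for the type of matrices used here: the index set
  of \<open>1, \<dots>, n\<close> becomes \<open>{..<n}\<close>, and the index \<open>-i = 2n+1-i\<close> becomes \<open>2 * n - 1 - i\<close>.
\<close>

definition exchange_mat :: "nat \<Rightarrow> complex mat" where
  "exchange_mat N = mat N N (\<lambda>(i, j). if i + j + 1 = N then 1 else 0)"

definition orthogonal_lie_algebra :: "nat \<Rightarrow> complex mat set" where
  "orthogonal_lie_algebra N =
     {X \<in> carrier_mat N N.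
        transpose_mat X * exchange_mat N + exchange_mat N * X = 0\<^sub>m N N}"

text \<open>Only meaningful for alternating matrices of even size.\<close>
definition pfaffian :: "complex mat \<Rightarrow> complex" where
  "pfaffian A =
     (let m = dim_row A div 2 in
        (\<Sum>\<sigma> | \<sigma> permutes {..<2 * m}.
           of_int (sign \<sigma>) * (\<Prod>i<m. A $$ (\<sigma> (2 * i), \<sigma> (2 * i + 1))))
        / (2 ^ m * fact m))"

text \<open>The Pfaffian of \<open>X \<in> \<oo>\<^bsub>2n\<^esub>\<close> is that of the alternating matrix \<open>X J\<^bsub>2n\<^esub>\<close>.\<close>
definition orthogonal_pfaffian :: "complex mat \<Rightarrow> complex" where
  "orthogonal_pfaffian X = pfaffian (X * exchange_mat (dim_row X))"

text \<open>
  The arrays \<open>b\<^bsub>i,j\<^esub> = X\<^bsub>i,-j\<^esub>\<close> and \<open>c\<^bsub>i,j\<^esub> = X\<^bsub>-j,i\<^esub>\<close>. They are not the upper right and lower left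
  blocks of \<open>X\<close>, but arise from them by reversing an index (and, for \<open>c\<close>, transposing).
\<close>
definition b_array :: "nat \<Rightarrow> complex mat \<Rightarrow> complex mat" where
  "b_array n X = mat n n (\<lambda>(i, j). X $$ (i, 2 * n - 1 - j))"

definition c_array :: "nat \<Rightarrow> complex mat \<Rightarrow> complex mat" where
  "c_array n X = mat n n (\<lambda>(i, j). X $$ (2 * n - 1 - j, i))"

text \<open>
  For finite disjoint sets \<open>A\<close>, \<open>B\<close> with union \<open>{..<n}\<close>, the sign of the permutation whose one-line
  notation lists \<open>A\<close> increasingly and then \<open>B\<close> increasingly.
\<close>
definition shuffle_sign :: "nat set \<Rightarrow> nat set \<Rightarrow> int" where
  "shuffle_sign A B =
     sign (\<lambda>k. if k < card A + card B
               then (sorted_list_of_set A @ sorted_list_of_set B) ! k else k)"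

text \<open>
  The block shape below is automatic for elements of \<open>\<oo>\<^bsub>2n\<^esub>\<close>, so assuming it only names the blocks.
\<close>
lemma orthogonal_lie_algebra_blocks:
  assumes X: "X \<in> orthogonal_lie_algebra (2 * n)"
  obtains a b c where
    "a \<in> carrier_mat n n" "b \<in> carrier_mat n n" "c \<in> carrier_mat n n"
    "X = four_block_mat a b c (- (exchange_mat n * transpose_mat a * exchange_mat n))"
proof -
  have dim: "X \<in> carrier_mat (2 * n) (2 * n)"
    using X by (simp add: orthogonal_lie_algebra_def)
  have right: "(A * exchange_mat m) $$ (i, j) = A $$ (i, m - 1 - j)"
    if "A \<in> carrier_mat m m" "i < m" "j < m" for A i j m
  proof -
    have "(A * exchange_mat m) $$ (i, j) =
        (\<Sum>k\<in>{0..<m}. A $$ (i, k) * (if k + j + 1 = m then 1 else 0))"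
      using that by (simp add: exchange_mat_def scalar_prod_def)
    also have "\<dots> = (\<Sum>k\<in>{0..<m}. if k = m - 1 - j then A $$ (i, k) else 0)"
      using that by (intro sum.cong) auto
    finally show ?thesis using that by simp
  qed
  have left: "(exchange_mat m * A) $$ (i, j) = A $$ (m - 1 - i, j)"
    if "A \<in> carrier_mat m m" "i < m" "j < m" for A i j m
  proof -
    have "(exchange_mat m * A) $$ (i, j) =
        (\<Sum>k\<in>{0..<m}. (if i + k + 1 = m then 1 else 0) * A $$ (k, j))"
      using that by (simp add: exchange_mat_def scalar_prod_def)
    also have "\<dots> = (\<Sum>k\<in>{0..<m}. if k = m - 1 - i then A $$ (k, j) else 0)"
      using that by (intro sum.cong) auto
    finally show ?thesis using that by simp
  qed
  have ex: "exchange_mat m \<in> carrier_mat m m" for m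
    by (simp add: exchange_mat_def)
  have skew: "X $$ (2 * n - 1 - j, i) + X $$ (2 * n - 1 - i, j) = 0"
    if "i < 2 * n" "j < 2 * n" for i j
  proof -
    have "(transpose_mat X * exchange_mat (2 * n) + exchange_mat (2 * n) * X) $$ (i, j) = 0"
      using X that by (simp add: orthogonal_lie_algebra_def)
    moreover have "(transpose_mat X * exchange_mat (2 * n) + exchange_mat (2 * n) * X) $$ (i, j)
        = (transpose_mat X * exchange_mat (2 * n)) $$ (i, j) + (exchange_mat (2 * n) * X) $$ (i, j)"
      using that dim ex[of "2 * n"] by (intro index_add_mat) auto
    ultimately show ?thesis
      using that dim right[of "transpose_mat X" "2 * n" i j] left[of X "2 * n" i j] by simp
  qed
  define a where "a = mat n n (\<lambda>(i, j). X $$ (i, j))"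
  define b where "b = mat n n (\<lambda>(i, j). X $$ (i, n + j))"
  define c where "c = mat n n (\<lambda>(i, j). X $$ (n + i, j))"
  let ?d = "- (exchange_mat n * transpose_mat a * exchange_mat n)"
  have carr: "a \<in> carrier_mat n n" "b \<in> carrier_mat n n" "c \<in> carrier_mat n n"
    by (simp_all add: a_def b_def c_def)
  have Ja: "exchange_mat n * transpose_mat a \<in> carrier_mat n n"
    using carr(1) ex[of n] by auto
  have d_dim: "dim_row ?d = n" "dim_col ?d = n"
    using ex[of n] by auto
  have d: "?d $$ (i, j) = X $$ (n + i, n + j)" if ij: "i < n" "j < n" for i j
  proof -
    have "?d $$ (i, j) = - ((exchange_mat n * transpose_mat a * exchange_mat n) $$ (i, j))"
      using ij ex[of n] by (intro index_uminus_mat) auto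
    also have "\<dots> = - a $$ (n - 1 - j, n - 1 - i)"
      using ij right[OF Ja ij] left[of "transpose_mat a" n i "n - 1 - j"] carr(1) by simp
    also have "\<dots> = - X $$ (n - 1 - j, n - 1 - i)"
      using ij by (simp add: a_def)
    also have "\<dots> = X $$ (n + i, n + j)"
    proof -
      have "2 * n - 1 - (n + j) = n - 1 - j" "2 * n - 1 - (n - 1 - i) = n + i"
        using ij by auto
      then show ?thesis
        using skew[of "n - 1 - i" "n + j"] ij by (simp add: add_eq_0_iff)
    qed
    finally show ?thesis .
  qed
  have "X = four_block_mat a b c ?d"
  proof (rule eq_matI)
    fix i j
    assume ij: "i < dim_row (four_block_mat a b c ?d)" "j < dim_col (four_block_mat a b c ?d)"
    then have *: "i < 2 * n" "j < 2 * n"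
      using carr d_dim by auto
    show "X $$ (i, j) = four_block_mat a b c ?d $$ (i, j)"
      using * carr d_dim d[of "i - n" "j - n"]
      by (subst index_mat_four_block(1)) (auto simp: a_def b_def c_def simp del: index_uminus_mat)
  qed (use dim carr d_dim in auto)
  with carr show ?thesis by (rule that)
qed

end

theory Submission
  imports Defs
begin

text \<open>
  Both sides satisfy the same recursion. The statement is proved for a more general shape: rows are
  indexed by a finite set \<open>R\<close>, columns by a finite set \<open>C\<close>, and the whole alternating matrix by \<open>R\<close>
  followed by a copy of \<open>C\<close> in reversed order, where \<open>card R + card C\<close> is even. The sum then runs over
  \<open>I \<subseteq> R\<close> and \<open>J \<subseteq> C\<close>, with the minor on the complements.

  The Pfaffian of the whole matrix is expanded along the smallest row index \<open>r\<close> (\<open>sub_pf_expand\<close>): its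
  partner is either another row, which leaves a smaller \<open>R\<close>, or a column, which leaves smaller \<open>R\<close> and
  \<open>C\<close>. In the sum over \<open>I\<close> and \<open>J\<close>, the terms with \<open>r \<in> I\<close> are expanded by the same rule applied to the
  Pfaffian over \<open>I\<close>, and the terms with \<open>r \<notin> I\<close> by Laplace expansion of the minor along row \<open>r\<close>
  (\<open>sub_det_expand\<close>); collecting terms gives \<open>pf_det_pf_sum_expand\<close>. The signs agree because every sign is
  written as a product over pairs of indices: with \<open>rank_sign\<close> and \<open>cross_sign\<close>, the sign of a partner
  within \<open>R\<close> splits into its sign within \<open>I\<close> and the change of the shuffle sign, and likewise within \<open>C\<close>.
  When no rows are left, only \<open>J = C\<close> survives and the two sides are the Pfaffian of an array and of
  its reversed transpose, which agree (\<open>sub_pf_image_decreasing\<close>). Induction on \<open>card R\<close> yields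
  \<open>sub_pf_block_expansion\<close>, of which the theorem is the case \<open>R = C = {..<n}\<close>.

  The expansion of the Pfaffian is derived from its definition as a sum over all permutations
  (\<open>pf_sum_Suc\<close>), and the shuffle signs are counted by inversions in \<open>shuffle_sign_eq_cross_sign\<close>.
\<close>

section \<open>Signs of ranks and shuffles\<close>

text \<open>
  The sign \<open>(-1)\<^sup>r\<close>, where \<open>r\<close> is the number of elements of \<open>S\<close> below \<open>y\<close>. For \<open>y \<in> S\<close> this \<open>r\<close> is
  the position of \<open>y\<close> in \<open>S\<close>, counted from 0, so this is the sign with which \<open>y\<close> enters an expansion along
  the first row. It is not required that \<open>y \<in> S\<close>.
\<close>
definition rank_sign :: "nat set \<Rightarrow> nat \<Rightarrow> complex" where
  "rank_sign S y = (-1) ^ card {z \<in> S. z < y}"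

text \<open>
  The sign \<open>(-1)\<^sup>r\<close>, where \<open>r\<close> is the number of inversions \<open>(x, y) \<in> A \<times> B\<close>, \<open>y < x\<close>. For disjoint finite
  sets it is the sign of the shuffle that lists \<open>A\<close> and then \<open>B\<close>.
\<close>
definition cross_sign :: "nat set \<Rightarrow> nat set \<Rightarrow> complex" where
  "cross_sign A B = (\<Prod>x\<in>A. rank_sign B x)"

lemma prod_if_minus_one:
  assumes "finite S"
  shows "(\<Prod>z\<in>S. if P z then -1 else 1 :: complex) = (-1) ^ card {z \<in> S. P z}"
proof -
  have "(\<Prod>z\<in>S. if P z then -1 else 1 :: complex) = (\<Prod>z\<in>{z \<in> S. P z}. -1)"
    using assms by (simp only: prod.inter_filter)
  then show ?thesis by (simp only: prod_constant)
qed

lemma rank_sign_prod: "finite S \<Longrightarrow> rank_sign S y = (\<Prod>z\<in>S. if z < y then -1 else 1)"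
  by (simp add: rank_sign_def prod_if_minus_one)

lemma rank_sign_union:
  assumes "finite S" "finite T" "S \<inter> T = {}"
  shows "rank_sign (S \<union> T) y = rank_sign S y * rank_sign T y"
  using assms by (simp add: rank_sign_prod prod.union_disjoint)

lemma rank_sign_lower: "(\<And>z. z \<in> S \<Longrightarrow> y < z) \<Longrightarrow> rank_sign S y = 1"
proof -
  assume "\<And>z. z \<in> S \<Longrightarrow> y < z"
  then have "{z \<in> S. z < y} = {}" using less_asym by blast
  then show ?thesis by (simp only: rank_sign_def card.empty power_0)
qed

lemma rank_sign_upper: "(\<And>z. z \<in> S \<Longrightarrow> z < y) \<Longrightarrow> rank_sign S y = (-1) ^ card S"
proof -
  assume "\<And>z. z \<in> S \<Longrightarrow> z < y"
  then have "{z \<in> S. z < y} = S" by blast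
  then show ?thesis by (simp add: rank_sign_def)
qed

lemma cross_sign_empty [simp]: "cross_sign {} B = 1" "cross_sign A {} = 1"
  by (simp_all add: cross_sign_def rank_sign_def)

lemma cross_sign_insert_left:
  "finite A \<Longrightarrow> x \<notin> A \<Longrightarrow> cross_sign (insert x A) B = rank_sign B x * cross_sign A B"
  by (simp add: cross_sign_def)

text \<open>
  Moving the pair \<open>r, y\<close> across \<open>Q\<close> when \<open>r\<close> is smaller than every element of \<open>Q\<close>: an element of \<open>Q\<close>
  above \<open>y\<close> is inverted twice, one below \<open>y\<close> only once.
\<close>
lemma cross_sign_insert_two_right:
  assumes "finite Q" "finite I" "y \<notin> Q" "r \<notin> I" "y \<notin> I" "r \<noteq> y" "\<And>x. x \<in> Q \<Longrightarrow> r < x"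
  shows "cross_sign Q (insert r (insert y I)) = cross_sign Q I * rank_sign Q y"
proof -
  have "rank_sign (insert r (insert y I)) x = rank_sign I x * (if x < y then -1 else 1)"
    if "x \<in> Q" for x
  proof -
    have "x \<noteq> y" using that assms(3) by auto
    then show ?thesis
      using assms that by (simp add: rank_sign_prod)
  qed
  then show ?thesis
    using assms(1) by (simp add: cross_sign_def rank_sign_prod[of Q] prod.distrib)
qed

section \<open>Enumerating a set after deletions\<close>

text \<open>
  Deleting \<open>x\<close> from \<open>S\<close> changes the increasing enumeration \<open>pick\<close> by skipping the rank of \<open>x\<close>. The same
  reindexing \<open>insert_index\<close> describes deleted rows and columns of a matrix and the insertion of a
  value into a permutation.
\<close>
lemma pick_remove:
  assumes S: "finite S" "x \<in> S" and i: "i < card (S - {x})"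
  shows "pick (S - {x}) i = pick S (insert_index (card {z \<in> S. z < x}) i)"
proof -
  define k where "k = card {z \<in> S. z < x}"
  define j where "j = insert_index k i"
  define w where "w = pick S j"
  have "card {z \<in> S. z < x} < card S"
    using S by (intro psubset_card_mono) auto
  then have k: "k < card S" by (simp add: k_def)
  have xk: "pick S k = x" using S by (simp add: k_def pick_card_in_set)
  have i': "Suc i < card S" using i S by (simp add: card_Diff_singleton)
  then have j: "j < card S" by (simp add: j_def insert_index_def)
  have jk: "j \<noteq> k" by (simp add: j_def)
  have w: "w \<in> S" and cw: "card {a \<in> S. a < w} = j"
    using j by (auto simp: w_def pick_in_set_le card_pick_le)
  have wx: "w \<noteq> x" using cw jk by (auto simp: k_def)
  have xw: "x < w \<longleftrightarrow> k < j"
    using pick_mono_le[OF j, of k] pick_mono_le[OF k, of j] jk xk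
    by (metis w_def linorder_neqE_nat less_asym)
  have "card {a \<in> S - {x}. a < w} = i"
  proof (cases "x < w")
    case True
    have "{a \<in> S - {x}. a < w} = {a \<in> S. a < w} - {x}" by auto
    then have "card {a \<in> S - {x}. a < w} = j - 1"
      using True S cw by (simp add: card_Diff_singleton)
    then show ?thesis using True xw by (auto simp: j_def insert_index_def split: if_splits)
  next
    case False
    then have "{a \<in> S - {x}. a < w} = {a \<in> S. a < w}" by auto
    then show ?thesis using False xw cw jk by (auto simp: j_def insert_index_def split: if_splits)
  qed
  then show ?thesis
    using pick_card_in_set[of w "S - {x}"] w wx by (simp add: w_def j_def k_def)
qed

lemma bij_betw_rank:
  fixes S :: "nat set"
  assumes "finite S"
  shows "bij_betw (\<lambda>y. card {z \<in> S. z < y}) S {..<card S}"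
proof (rule bij_betwI[where g = "pick S"])
  show "(\<lambda>y. card {z \<in> S. z < y}) \<in> S \<rightarrow> {..<card S}"
    using assms by (auto intro!: psubset_card_mono)
qed (auto simp: pick_card_in_set pick_in_set_le card_pick_le)

lemma pick_unique:
  assumes "x \<in> S" "card {a \<in> S. a < x} = i"
  shows "pick S i = x"
  using pick_card_in_set[of x S] assms by simp

lemma pick_lessThan: "i < n \<Longrightarrow> pick {..<n} i = i"
proof (rule pick_unique)
  assume "i < n"
  then have "{a \<in> {..<n}. a < i} = {..<i}" by auto
  then show "card {a \<in> {..<n}. a < i} = i" by simp
qed simp

lemma pick_Min:
  assumes "r \<in> S" "\<And>x. x \<in> S \<Longrightarrow> r \<le> x"
  shows "pick S 0 = r"
  using assms by (auto intro!: Least_equality)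

section \<open>Expansion of the Pfaffian along its first index\<close>

text \<open>
  One summand of the permutation sum in the Pfaffian of the array \<open>f\<close> restricted to \<open>2 * m\<close> indices.
\<close>
definition pf_term :: "nat \<Rightarrow> (nat \<Rightarrow> nat \<Rightarrow> complex) \<Rightarrow> (nat \<Rightarrow> nat) \<Rightarrow> complex" where
  "pf_term m f \<sigma> = of_int (sign \<sigma>) * (\<Prod>i<m. f (\<sigma> (2 * i)) (\<sigma> (2 * i + 1)))"

text \<open>
  The permutation sum of the Pfaffian, before division by \<open>2\<^sup>m m!\<close>.
\<close>
definition pf_sum :: "nat \<Rightarrow> (nat \<Rightarrow> nat \<Rightarrow> complex) \<Rightarrow> complex" where
  "pf_sum m f = (\<Sum>\<sigma> | \<sigma> permutes {0..<2 * m}. pf_term m f \<sigma>)"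

lemma pfaffian_mat:
  "pfaffian (mat (2 * m) (2 * m) (\<lambda>(i, j). f i j)) = pf_sum m f / (2 ^ m * fact m)"
proof -
  have "of_int (sign \<sigma>) *
      (\<Prod>i<m. mat (2 * m) (2 * m) (\<lambda>(i, j). f i j) $$ (\<sigma> (2 * i), \<sigma> (2 * i + 1))) = pf_term m f \<sigma>"
    if "\<sigma> permutes {0..<2 * m}" for \<sigma>
  proof -
    have "\<sigma> x < 2 * m" if "x < 2 * m" for x
      using permutes_in_image[OF \<open>\<sigma> permutes {0..<2 * m}\<close>, of x] that by simp
    then show ?thesis by (auto simp: pf_term_def intro!: prod.cong)
  qed
  then show ?thesis
    by (simp add: pfaffian_def pf_sum_def lessThan_atLeast0)
qed

lemma pf_term_cong:
  assumes "\<sigma> permutes {0..<2 * m}" "\<And>i j. i < 2 * m \<Longrightarrow> j < 2 * m \<Longrightarrow> f i j = g i j"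
  shows "pf_term m f \<sigma> = pf_term m g \<sigma>"
proof -
  have "\<sigma> x < 2 * m" if "x < 2 * m" for x
    using permutes_in_image[OF assms(1), of x] that by simp
  then show ?thesis using assms(2) by (auto simp: pf_term_def intro!: prod.cong)
qed

lemma pf_sum_cong:
  assumes "\<And>i j. i < 2 * m \<Longrightarrow> j < 2 * m \<Longrightarrow> f i j = g i j"
  shows "pf_sum m f = pf_sum m g"
  unfolding pf_sum_def using assms by (auto intro!: sum.cong pf_term_cong)

lemma pf_term_flip:
  assumes f: "\<And>i j. f j i = - f i j" and q: "q < m" and \<sigma>: "\<sigma> permutes {0..<2 * m}"
  shows "pf_term m f (\<sigma> \<circ> transpose (2 * q) (2 * q + 1)) = pf_term m f \<sigma>"
proof -
  let ?t = "transpose (2 * q) (2 * q + 1)"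
  have t: "?t permutes {0..<2 * m}" using q by (intro permutes_swap_id) auto
  have s: "sign (\<sigma> \<circ> ?t) = - sign \<sigma>"
    using t \<sigma> by (subst sign_compose) (auto simp: permutation_permutes sign_swap_id intro: exI[of _ "{0..<2*m}"])
  have "(\<Prod>i<m. f ((\<sigma> \<circ> ?t) (2 * i)) ((\<sigma> \<circ> ?t) (2 * i + 1)))
      = f (\<sigma> (2 * q + 1)) (\<sigma> (2 * q)) * (\<Prod>i\<in>{..<m} - {q}. f (\<sigma> (2 * i)) (\<sigma> (2 * i + 1)))"
  proof (subst prod.remove[of _ q])
    have "?t (2 * i) = 2 * i" "?t (2 * i + 1) = 2 * i + 1" if "i \<noteq> q" for i
      using that by (simp_all add: transpose_def; presburger)+
    then show "f ((\<sigma> \<circ> ?t) (2 * q)) ((\<sigma> \<circ> ?t) (2 * q + 1)) *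
        (\<Prod>i\<in>{..<m} - {q}. f ((\<sigma> \<circ> ?t) (2 * i)) ((\<sigma> \<circ> ?t) (2 * i + 1)))
      = f (\<sigma> (2 * q + 1)) (\<sigma> (2 * q)) * (\<Prod>i\<in>{..<m} - {q}. f (\<sigma> (2 * i)) (\<sigma> (2 * i + 1)))"
      by (intro arg_cong2[of _ _ _ _ "(*)"] prod.cong) auto
  qed (use q in auto)
  also have "\<dots> = - (\<Prod>i<m. f (\<sigma> (2 * i)) (\<sigma> (2 * i + 1)))"
    using prod.remove[of "{..<m}" q "\<lambda>i. f (\<sigma> (2 * i)) (\<sigma> (2 * i + 1))"] q
    by (simp only: f[of "\<sigma> (2 * q + 1)" "\<sigma> (2 * q)"] finite_lessThan lessThan_iff mult_minus_left)
  finally show ?thesis unfolding pf_term_def s by simp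
qed

lemma pf_term_swap:
  assumes q: "q < m" and \<sigma>: "\<sigma> permutes {0..<2 * m}"
  shows "pf_term m f (\<sigma> \<circ> (transpose 0 (2 * q) \<circ> transpose 1 (2 * q + 1))) = pf_term m f \<sigma>"
proof -
  let ?s = "transpose 0 (2 * q)" and ?t = "transpose 1 (2 * q + 1)"
  have t: "?s permutes {0..<2 * m}" "?t permutes {0..<2 * m}"
    using q by (auto intro!: permutes_swap_id)
  have p: "permutation ?s" "permutation ?t" "permutation \<sigma>"
    using t \<sigma> by (auto simp: permutation_permutes)
  have s: "sign (\<sigma> \<circ> (?s \<circ> ?t)) = sign \<sigma>"
    using p by (simp add: sign_compose permutation_compose sign_swap_id)
  have 1: "(?s \<circ> ?t) (2 * i) = 2 * transpose 0 q i" for i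
    by (simp add: transpose_def; presburger)
  have 2: "(?s \<circ> ?t) (2 * i + 1) = 2 * transpose 0 q i + 1" for i
    by (simp add: transpose_def; presburger)
  have "(\<Prod>i<m. f ((\<sigma> \<circ> (?s \<circ> ?t)) (2 * i)) ((\<sigma> \<circ> (?s \<circ> ?t)) (2 * i + 1)))
     = (\<Prod>i<m. ((\<lambda>i. f (\<sigma> (2 * i)) (\<sigma> (2 * i + 1))) \<circ> transpose 0 q) i)"
    using 1 2 by (simp add: comp_def)
  also have "\<dots> = (\<Prod>i<m. f (\<sigma> (2 * i)) (\<sigma> (2 * i + 1)))"
    using q by (intro prod.permute[symmetric] permutes_swap_id) auto
  finally show ?thesis unfolding pf_term_def s by simp
qed

lemma sum_permutes_move:
  assumes \<pi>: "\<pi> permutes S" and g: "\<And>\<sigma>. \<sigma> permutes S \<Longrightarrow> g (\<sigma> \<circ> \<pi>) = g \<sigma>"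
  shows "(\<Sum>\<sigma> | \<sigma> permutes S \<and> \<sigma> (\<pi> p) = v. g \<sigma>) = (\<Sum>\<sigma> | \<sigma> permutes S \<and> \<sigma> p = v. g \<sigma>)"
proof (rule sum.reindex_bij_witness[where j = "\<lambda>\<sigma>. \<sigma> \<circ> \<pi>" and i = "\<lambda>\<sigma>. \<sigma> \<circ> inv_into UNIV \<pi>"])
qed (auto simp: fun_eq_iff permutes_inverses[OF \<pi>] g permutes_compose[OF \<pi>]
       permutes_compose[OF permutes_inv[OF \<pi>]])

text \<open>
  Flipping the two entries of a pair and exchanging two pairs do not change a summand, so the index 0 may
  be assumed to occupy the first position: each of the \<open>2 * m\<close> positions contributes equally.
\<close>
lemma pf_sum_fix_first:
  assumes f: "\<And>i j. f j i = - f i j" and m: "m > 0"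
  shows "pf_sum m f = of_nat (2 * m) *
    (\<Sum>\<sigma> | \<sigma> permutes {0..<2 * m} \<and> \<sigma> 0 = 0. pf_term m f \<sigma>)"
proof -
  let ?S = "{0..<2 * m}"
  let ?B = "\<lambda>p. \<Sum>\<sigma> | \<sigma> permutes ?S \<and> \<sigma> p = 0. pf_term m f \<sigma>"
  have even_pos: "?B (2 * q) = ?B 0" if "q < m" for q
  proof -
    let ?\<pi> = "transpose 0 (2 * q) \<circ> transpose 1 (2 * q + 1)"
    have "?\<pi> permutes ?S"
      using that by (intro permutes_compose permutes_swap_id) auto
    moreover have "?\<pi> 0 = 2 * q" by (simp add: transpose_def)
    ultimately show ?thesis
      using sum_permutes_move[of ?\<pi> ?S "pf_term m f" 0 0] pf_term_swap[OF that] by simp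
  qed
  have odd_pos: "?B (2 * q + 1) = ?B (2 * q)" if "q < m" for q
  proof -
    let ?\<pi> = "transpose (2 * q) (2 * q + 1)"
    have "?\<pi> permutes ?S"
      using that by (intro permutes_swap_id) auto
    then show ?thesis
      using sum_permutes_move[of ?\<pi> ?S "pf_term m f" "2 * q" 0] pf_term_flip[OF f that] by simp
  qed
  have B: "?B p = ?B 0" if "p < 2 * m" for p
  proof (cases "even p")
    case True
    then obtain q where "p = 2 * q" by (rule evenE)
    then show ?thesis using even_pos[of q] that by simp
  next
    case False
    then obtain q where "p = 2 * q + 1" by (rule oddE)
    then show ?thesis using even_pos[of q] odd_pos[of q] that by simp
  qed
  have "pf_sum m f = (\<Sum>\<sigma>\<in>(\<Union>p\<in>?S. {\<sigma>. \<sigma> permutes ?S \<and> \<sigma> p = 0}). pf_term m f \<sigma>)"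
    unfolding pf_sum_def using permutation_split_ran[of 0 ?S] m by simp
  also have "\<dots> = (\<Sum>p\<in>?S. ?B p)"
  proof (rule sum.UNION_disjoint)
    show "\<forall>p\<in>?S. finite {\<sigma>. \<sigma> permutes ?S \<and> \<sigma> p = 0}"
      by (auto intro: finite_subset[OF _ finite_permutations[of ?S]])
    show "\<forall>p\<in>?S. \<forall>p'\<in>?S. p \<noteq> p' \<longrightarrow>
        {\<sigma>. \<sigma> permutes ?S \<and> \<sigma> p = 0} \<inter> {\<sigma>. \<sigma> permutes ?S \<and> \<sigma> p' = 0} = {}"
      using permutation_disjoint_dom[of _ ?S _ 0] m by auto
  qed simp
  also have "\<dots> = (\<Sum>p\<in>?S. ?B 0)"
    by (intro sum.cong refl B) simp
  finally show ?thesis by simp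
qed

text \<open>
  A permutation of \<open>2 * m + 2\<close> points fixing 0 is determined by the partner \<open>Suc y\<close> of 0 and a permutation
  of the remaining \<open>2 * m\<close> points; it is obtained by two successive insertions, the second
  of which contributes the sign \<open>(-1)\<^sup>y\<close>.
\<close>
lemma pf_sum_Suc:
  assumes f: "\<And>i j. f j i = - f i j"
  shows "pf_sum (Suc m) f = of_nat (2 * Suc m) * (\<Sum>y<2 * m + 1. (-1) ^ y * f 0 (Suc y) *
      pf_sum m (\<lambda>i j. f (Suc (insert_index y i)) (Suc (insert_index y j))))"
proof -
  let ?M = "2 * m + 1"
  let ?h = "\<lambda>\<tau>. of_int (sign \<tau>) * (f 0 (Suc (\<tau> 0)) *
    (\<Prod>i<m. f (Suc (\<tau> (2 * i + 1))) (Suc (\<tau> (2 * i + 2)))))"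
  let ?f = "\<lambda>y i j. f (Suc (insert_index y i)) (Suc (insert_index y j))"
  have first: "pf_term (Suc m) f (permutation_insert 0 0 \<tau>) = ?h \<tau>"
    if \<tau>: "\<tau> permutes {0..<?M}" for \<tau>
  proof -
    have "permutation_insert 0 0 \<tau> (Suc x) = Suc (\<tau> x)" for x
      by (simp add: permutation_insert_expand)
    then have ins: "permutation_insert 0 0 \<tau> (2 * Suc i) = Suc (\<tau> (2 * i + 1))"
        "permutation_insert 0 0 \<tau> (2 * Suc i + 1) = Suc (\<tau> (2 * i + 2))"
        "permutation_insert 0 0 \<tau> (2 * 0 + 1) = Suc (\<tau> 0)"
        "permutation_insert 0 0 \<tau> (2 * 0) = 0" for i
      by simp_all
    have "sign (permutation_insert 0 0 \<tau>) = sign \<tau>"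
      using signof_permutation_insert[OF \<tau>, of 0 0, where 'a = int] by simp
    then show ?thesis
      unfolding pf_term_def prod.lessThan_Suc_shift ins by simp
  qed
  have second: "?h (permutation_insert 0 y \<rho>) = (-1) ^ y * f 0 (Suc y) * pf_term m (?f y) \<rho>"
    if \<rho>: "\<rho> permutes {0..<2 * m}" and y: "y < ?M" for \<rho> y
  proof -
    have "permutation_insert 0 y \<rho> (Suc x) = insert_index y (\<rho> x)" for x
      by (simp add: permutation_insert_expand insert_index_def)
    then have ins: "permutation_insert 0 y \<rho> (2 * i + 1) = insert_index y (\<rho> (2 * i))"
        "permutation_insert 0 y \<rho> (2 * i + 2) = insert_index y (\<rho> (2 * i + 1))" for i
      by simp_all
    have sgn: "sign (permutation_insert 0 y \<rho>) = (-1) ^ y * sign \<rho>"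
      using signof_permutation_insert[OF \<rho>, of 0 y, where 'a = int] y by simp
    show ?thesis
      unfolding pf_term_def ins sgn by simp
  qed
  have fixed: "{\<sigma>. \<sigma> permutes {0..<2 * Suc m} \<and> \<sigma> 0 = 0} = permutation_insert 0 0 ` {\<tau>. \<tau> permutes {0..<?M}}"
    using permutation_fix[of 0 "?M" 0] by simp
  have inj0: "inj_on (permutation_insert 0 0) {\<tau>. \<tau> permutes {0..<?M}}"
    by (rule permutation_insert_inj_on) auto
  have split: "{\<tau>. \<tau> permutes {0..<?M}} = (\<Union>y<?M. permutation_insert 0 y ` {\<rho>. \<rho> permutes {0..<2 * m}})"
  proof -
    have "\<tau> 0 < ?M" if "\<tau> permutes {0..<?M}" for \<tau>
      using permutes_in_image[OF that, of 0] by simp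
    then have "{\<tau>. \<tau> permutes {0..<?M}} = (\<Union>y<?M. {\<tau>. \<tau> permutes {0..<?M} \<and> \<tau> 0 = y})"
      by blast
    also have "\<dots> = (\<Union>y<?M. permutation_insert 0 y ` {\<rho>. \<rho> permutes {0..<2 * m}})"
      using permutation_fix[of 0 "2 * m"] by (intro SUP_cong) auto
    finally show ?thesis .
  qed
  have "(\<Sum>\<sigma> | \<sigma> permutes {0..<2 * Suc m} \<and> \<sigma> 0 = 0. pf_term (Suc m) f \<sigma>)
      = (\<Sum>\<tau> | \<tau> permutes {0..<?M}. ?h \<tau>)"
    unfolding fixed sum.reindex[OF inj0] comp_def by (intro sum.cong refl first) simp
  also have "\<dots> = (\<Sum>y<?M. \<Sum>\<tau>\<in>permutation_insert 0 y ` {\<rho>. \<rho> permutes {0..<2 * m}}. ?h \<tau>)"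
    unfolding split
  proof (rule sum.UNION_disjoint)
    show "\<forall>y\<in>{..<?M}. \<forall>y'\<in>{..<?M}. y \<noteq> y' \<longrightarrow>
      permutation_insert 0 y ` {\<rho>. \<rho> permutes {0..<2 * m}} \<inter>
      permutation_insert 0 y' ` {\<rho>. \<rho> permutes {0..<2 * m}} = {}"
      unfolding disjoint_iff by (metis imageE permutation_insert_inserted)
  qed (auto intro: finite_permutations)
  also have "\<dots> = (\<Sum>y<?M. (-1) ^ y * f 0 (Suc y) * pf_sum m (?f y))"
  proof (rule sum.cong[OF refl])
    fix y assume "y \<in> {..<?M}"
    then have y: "y < ?M" by simp
    have "inj_on (permutation_insert 0 y) {\<rho>. \<rho> permutes {0..<2 * m}}"
      using y by (intro permutation_insert_inj_on) auto
    then have "(\<Sum>\<tau>\<in>permutation_insert 0 y ` {\<rho>. \<rho> permutes {0..<2 * m}}. ?h \<tau>)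
        = (\<Sum>\<rho> | \<rho> permutes {0..<2 * m}. ?h (permutation_insert 0 y \<rho>))"
      by (subst sum.reindex) simp_all
    also have "\<dots> = (-1) ^ y * f 0 (Suc y) * pf_sum m (?f y)"
      unfolding pf_sum_def sum_distrib_left using y
      by (intro sum.cong refl second) auto
    finally show "(\<Sum>\<tau>\<in>permutation_insert 0 y ` {\<rho>. \<rho> permutes {0..<2 * m}}. ?h \<tau>)
        = (-1) ^ y * f 0 (Suc y) * pf_sum m (?f y)" .
  qed
  finally show ?thesis
    using pf_sum_fix_first[OF f, of "Suc m"] by simp
qed

section \<open>Pfaffians and minors indexed by sets\<close>

text \<open>
  The Pfaffian of the array \<open>f\<close> restricted to the indices in \<open>S\<close>, taken increasingly; it is 0 if \<open>S\<close> has
  an odd number of elements.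
\<close>
definition sub_pf :: "(nat \<Rightarrow> nat \<Rightarrow> complex) \<Rightarrow> nat set \<Rightarrow> complex" where
  "sub_pf f S = (if even (card S)
     then pfaffian (mat (card S) (card S) (\<lambda>(i, j). f (pick S i) (pick S j))) else 0)"

text \<open>
  The minor of the array \<open>f\<close> with rows \<open>R\<close> and columns \<open>C\<close>; it is 0 if the minor is not square. With
  these default values the expansions along the first row hold without assumptions on cardinalities.
\<close>
definition sub_det :: "(nat \<Rightarrow> nat \<Rightarrow> complex) \<Rightarrow> nat set \<Rightarrow> nat set \<Rightarrow> complex" where
  "sub_det f R C = (if card R = card C
     then det (mat (card R) (card R) (\<lambda>(i, j). f (pick R i) (pick C j))) else 0)"

lemma sub_pf_even:
  assumes "card S = 2 * m"
  shows "sub_pf f S = pf_sum m (\<lambda>i j. f (pick S i) (pick S j)) / (2 ^ m * fact m)"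
  using assms by (simp add: sub_pf_def pfaffian_mat)

lemma sub_pf_empty [simp]: "sub_pf f {} = 1"
  by (simp add: sub_pf_even[where m = 0] pf_sum_def pf_term_def)

lemma sub_pf_expand:
  assumes f: "\<And>i j. f j i = - f i j"
    and S: "finite S" "\<And>x. x \<in> S \<Longrightarrow> r < x"
  shows "sub_pf f (insert r S) = (\<Sum>y\<in>S. rank_sign S y * f r y * sub_pf f (S - {y}))"
proof (cases "even (card S)")
  case True
  have r: "r \<notin> S" using S by auto
  have "sub_pf f (S - {y}) = 0" if "y \<in> S" for y
  proof -
    have "card S = Suc (card (S - {y}))" using S(1) that by (rule card.remove)
    then have "odd (card (S - {y}))" using True by simp
    then show ?thesis by (simp add: sub_pf_def)
  qed
  then show ?thesis
    using True r S by (simp add: sub_pf_def)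
next
  case False
  then obtain m where m: "card S = 2 * m + 1" by (rule oddE)
  let ?T = "insert r S"
  have r: "r \<notin> S" using S by auto
  have T: "finite ?T" "card ?T = 2 * Suc m" "?T - {r} = S"
    using r S m by auto
  have rT: "{z \<in> ?T. z < r} = {}" using S(2) by (auto dest: less_asym)
  have p0: "pick ?T 0 = r"
    using S(2) by (intro pick_Min) (auto intro: less_imp_le)
  have pS: "pick ?T (Suc i) = pick S i" if "i < card S" for i
    using pick_remove[of ?T r i] T that by (simp only: rT) (simp add: insert_index_def)
  define g where "g = (\<lambda>i j. f (pick ?T i) (pick ?T j))"
  have g: "g j i = - g i j" for i j unfolding g_def by (rule f)
  have step: "pf_sum m (\<lambda>i j. g (Suc (insert_index (card {z \<in> S. z < y}) i))
          (Suc (insert_index (card {z \<in> S. z < y}) j)))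
      = pf_sum m (\<lambda>i j. f (pick (S - {y}) i) (pick (S - {y}) j))" if "y \<in> S" for y
  proof -
    let ?k = "card {z \<in> S. z < y}"
    have "pick ?T (Suc (insert_index ?k i)) = pick (S - {y}) i" if "i < 2 * m" for i
    proof -
      have "insert_index ?k i < card S" using that m by (simp add: insert_index_def)
      moreover have "i < card (S - {y})" using that m \<open>y \<in> S\<close> S by (simp add: card_Diff_singleton)
      ultimately show ?thesis using pS pick_remove[OF S(1) \<open>y \<in> S\<close>] by simp
    qed
    then show ?thesis by (intro pf_sum_cong) (simp add: g_def)
  qed
  have "pf_sum (Suc m) g = of_nat (2 * Suc m) * (\<Sum>k<card S. (-1) ^ k * g 0 (Suc k) *
      pf_sum m (\<lambda>i j. g (Suc (insert_index k i)) (Suc (insert_index k j))))"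
    unfolding m by (rule pf_sum_Suc) (rule g)
  also have "\<dots> = of_nat (2 * Suc m) * (\<Sum>y\<in>S. rank_sign S y * f r y *
      pf_sum m (\<lambda>i j. f (pick (S - {y}) i) (pick (S - {y}) j)))"
  proof (subst sum.reindex_bij_betw[OF bij_betw_rank[OF S(1)], symmetric], rule arg_cong2[OF refl, of _ _ "(*)"],
      rule sum.cong[OF refl])
    fix y assume y: "y \<in> S"
    let ?k = "card {z \<in> S. z < y}"
    have "?k < card S" using y S by (intro psubset_card_mono) auto
    then have "g 0 (Suc ?k) = f r y"
      using pS p0 y by (simp add: g_def pick_card_in_set del: pick.simps)
    then show "(-1) ^ ?k * g 0 (Suc ?k) * pf_sum m (\<lambda>i j. g (Suc (insert_index ?k i)) (Suc (insert_index ?k j)))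
        = rank_sign S y * f r y * pf_sum m (\<lambda>i j. f (pick (S - {y}) i) (pick (S - {y}) j))"
      by (simp only: rank_sign_def step[OF y])
  qed
  finally have *: "pf_sum (Suc m) g = of_nat (2 * Suc m) * (\<Sum>y\<in>S. rank_sign S y * f r y *
      pf_sum m (\<lambda>i j. f (pick (S - {y}) i) (pick (S - {y}) j)))" .
  have "sub_pf f ?T = pf_sum (Suc m) g / (2 ^ Suc m * fact (Suc m))"
    using T by (simp only: sub_pf_even[of ?T "Suc m"] g_def)
  also have "\<dots> = (\<Sum>y\<in>S. rank_sign S y * f r y *
      pf_sum m (\<lambda>i j. f (pick (S - {y}) i) (pick (S - {y}) j))) / (2 ^ m * fact m)"
  proof -
    have "(of_nat (2 * Suc m) :: complex) \<noteq> 0" by (simp only: of_nat_eq_0_iff) simp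
    moreover have "(2 ^ Suc m * fact (Suc m) :: complex) = of_nat (2 * Suc m) * (2 ^ m * fact m)"
      by (simp add: algebra_simps)
    ultimately show ?thesis by (simp only: * mult_divide_mult_cancel_left_if if_False)
  qed
  also have "\<dots> = (\<Sum>y\<in>S. rank_sign S y * f r y * sub_pf f (S - {y}))"
  proof -
    have "sub_pf f (S - {y}) = pf_sum m (\<lambda>i j. f (pick (S - {y}) i) (pick (S - {y}) j)) / (2 ^ m * fact m)"
      if "y \<in> S" for y
      using that m S by (intro sub_pf_even) (simp add: card_Diff_singleton)
    then show ?thesis by (simp add: sum_divide_distrib)
  qed
  finally show ?thesis .
qed

lemma sub_det_empty [simp]: "sub_det f {} {} = 1"
  by (simp add: sub_det_def det_def)

lemma sub_det_expand:
  assumes R: "finite R" "\<And>x. x \<in> R \<Longrightarrow> r < x" and C: "finite C"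
  shows "sub_det f (insert r R) C = (\<Sum>c\<in>C. rank_sign C c * f r c * sub_det f R (C - {c}))"
proof (cases "card C = Suc (card R)")
  case False
  have r: "r \<notin> R" using R by auto
  have "sub_det f R (C - {c}) = 0" if "c \<in> C" for c
  proof -
    have "card C = Suc (card (C - {c}))" using C that by (rule card.remove)
    then show ?thesis using False by (simp add: sub_det_def)
  qed
  then show ?thesis using False r R by (simp add: sub_det_def)
next
  case True
  let ?T = "insert r R"
  let ?n = "Suc (card R)"
  have r: "r \<notin> R" using R by auto
  have T: "finite ?T" "card ?T = ?n" "?T - {r} = R"
    using r R by auto
  have rT: "{z \<in> ?T. z < r} = {}" using R(2) by (auto dest: less_asym)
  have p0: "pick ?T 0 = r"
    using R(2) by (intro pick_Min) (auto intro: less_imp_le)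
  have pR: "pick ?T (Suc i) = pick R i" if "i < card R" for i
    using pick_remove[of ?T r i] T that by (simp only: rT) (simp add: insert_index_def)
  define M where "M = mat ?n ?n (\<lambda>(i, j). f (pick ?T i) (pick C j))"
  have M: "M \<in> carrier_mat ?n ?n" by (simp add: M_def)
  have "sub_det f ?T C = det M" using True T by (simp add: sub_det_def M_def del: pick.simps)
  also have "\<dots> = (\<Sum>j<?n. M $$ (0, j) * cofactor M 0 j)"
    by (rule laplace_expansion_row[OF M]) simp
  also have "\<dots> = (\<Sum>c\<in>C. M $$ (0, card {z \<in> C. z < c}) * cofactor M 0 (card {z \<in> C. z < c}))"
    using sum.reindex_bij_betw[OF bij_betw_rank[OF C], of "\<lambda>j. M $$ (0, j) * cofactor M 0 j"] True by simp
  also have "\<dots> = (\<Sum>c\<in>C. rank_sign C c * f r c * sub_det f R (C - {c}))"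
  proof (rule sum.cong[OF refl])
    fix c assume c: "c \<in> C"
    let ?k = "card {z \<in> C. z < c}"
    have k: "?k < ?n" unfolding True[symmetric] using c C by (intro psubset_card_mono) auto
    have cc: "card (C - {c}) = card R" using True c C by (simp add: card_Diff_singleton)
    have "mat_delete M 0 ?k = mat (card R) (card R) (\<lambda>(i, j). f (pick R i) (pick (C - {c}) j))"
    proof (rule eq_matI)
      fix i j
      assume "i < dim_row (mat (card R) (card R) (\<lambda>(i, j). f (pick R i) (pick (C - {c}) j)))"
        "j < dim_col (mat (card R) (card R) (\<lambda>(i, j). f (pick R i) (pick (C - {c}) j)))"
      then have ij: "i < card R" "j < card R" by simp_all
      have "mat_delete M 0 ?k $$ (i, j) = M $$ (insert_index 0 i, insert_index ?k j)"
        by (rule mat_delete_index[OF M _ k ij, symmetric]) simp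
      also have "\<dots> = f (pick ?T (Suc i)) (pick C (insert_index ?k j))"
        using ij by (simp add: M_def insert_index_def del: pick.simps)
      also have "\<dots> = f (pick R i) (pick (C - {c}) j)"
        using pR[OF ij(1)] pick_remove[OF C c, of j] ij cc by simp
      finally show "mat_delete M 0 ?k $$ (i, j)
          = mat (card R) (card R) (\<lambda>(i, j). f (pick R i) (pick (C - {c}) j)) $$ (i, j)"
        using ij by simp
    qed (simp_all add: M_def)
    moreover have "M $$ (0, ?k) = f r c"
      using k p0 c by (simp add: M_def pick_card_in_set del: pick.simps)
    ultimately show "M $$ (0, ?k) * cofactor M 0 ?k = rank_sign C c * f r c * sub_det f R (C - {c})"
      by (simp add: cofactor_def sub_det_def cc rank_sign_def)
  qed
  finally show ?thesis .
qed

lemma pick_image_decreasing: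
  assumes C: "finite C" and \<nu>: "\<And>x y. x \<in> C \<Longrightarrow> y \<in> C \<Longrightarrow> x < y \<Longrightarrow> \<nu> y < \<nu> x"
    and i: "i < card C"
  shows "pick (\<nu> ` C) i = \<nu> (pick C (card C - 1 - i))"
proof -
  define x where "x = pick C (card C - 1 - i)"
  have lt: "card C - 1 - i < card C" using i by simp
  have x: "x \<in> C" "card {a \<in> C. a < x} = card C - 1 - i"
    unfolding x_def using pick_in_set_le[OF lt] card_pick_le[OF lt] by auto
  have iff: "\<nu> a < \<nu> x \<longleftrightarrow> x < a" if "a \<in> C" for a
    using \<nu>[of a x] \<nu>[of x a] x that by (metis less_asym less_irrefl linorder_neqE_nat)
  have inj: "inj_on \<nu> C"
    by (rule inj_onI) (metis \<nu> less_irrefl linorder_neqE_nat)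
  have "{a \<in> \<nu> ` C. a < \<nu> x} = \<nu> ` {a \<in> C. x < a}" using iff by auto
  then have "card {a \<in> \<nu> ` C. a < \<nu> x} = card {a \<in> C. x < a}"
    using inj by (simp add: card_image inj_on_subset)
  also have "\<dots> = i"
  proof -
    have "C = {a \<in> C. a < x} \<union> {x} \<union> {a \<in> C. x < a}" using x by auto
    then have "card C = card ({a \<in> C. a < x} \<union> {x} \<union> {a \<in> C. x < a})" by simp
    also have "\<dots> = card {a \<in> C. a < x} + 1 + card {a \<in> C. x < a}"
      using C by (subst card_Un_disjoint; (subst card_Un_disjoint)?) auto
    finally show ?thesis using x i by simp
  qed
  finally show ?thesis using x by (intro pick_unique) (auto simp: x_def)
qed

text \<open>
  Reversing all indices and transposing leaves the permutation sum unchanged. Conjugation by the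
  reversal \<open>w\<close> preserves signs, and the pair at position \<open>i\<close> becomes the flipped pair at position
  \<open>m - 1 - i\<close>, so no sign has to be computed.
\<close>
lemma pf_sum_reverse:
  "pf_sum m (\<lambda>i j. f (2 * m - 1 - i) (2 * m - 1 - j)) = pf_sum m (\<lambda>i j. f j i)"
proof -
  let ?S = "{0..<2 * m}"
  define w where "w = (\<lambda>i. if i < 2 * m then 2 * m - 1 - i else i)"
  have ww: "w (w i) = i" for i by (auto simp: w_def)
  have w_inv: "w \<circ> w = id" by (simp add: fun_eq_iff ww)
  have w: "w permutes ?S"
    by (rule bij_imp_permutes) (auto simp: w_def intro!: bij_betwI[where g = w])
  have pw: "permutation w" using w by (auto simp: permutation_permutes)
  have "pf_sum m (\<lambda>i j. f (2 * m - 1 - i) (2 * m - 1 - j)) = pf_sum m (\<lambda>i j. f (w i) (w j))"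
    by (intro pf_sum_cong) (simp add: w_def)
  also have "\<dots> = pf_sum m (\<lambda>i j. f j i)"
    unfolding pf_sum_def
  proof (rule sum.reindex_bij_witness[where i = "\<lambda>\<sigma>. w \<circ> \<sigma> \<circ> w" and j = "\<lambda>\<sigma>. w \<circ> \<sigma> \<circ> w"])
    fix \<sigma> assume "\<sigma> \<in> {\<sigma>. \<sigma> permutes ?S}"
    then have \<sigma>: "\<sigma> permutes ?S" by simp
    then have p\<sigma>: "permutation \<sigma>" by (auto simp: permutation_permutes)
    have sgn: "sign (w \<circ> \<sigma> \<circ> w) = sign \<sigma>"
      using pw p\<sigma> by (simp add: sign_compose permutation_compose)
    have "(\<Prod>i<m. f ((w \<circ> \<sigma> \<circ> w) (2 * i + 1)) ((w \<circ> \<sigma> \<circ> w) (2 * i)))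
        = (\<Prod>i<m. f (w (\<sigma> (2 * (m - Suc i)))) (w (\<sigma> (2 * (m - Suc i) + 1))))"
    proof (rule prod.cong[OF refl])
      fix i assume "i \<in> {..<m}"
      then have "w (2 * i + 1) = 2 * (m - Suc i)" "w (2 * i) = 2 * (m - Suc i) + 1"
        by (auto simp: w_def)
      then show "f ((w \<circ> \<sigma> \<circ> w) (2 * i + 1)) ((w \<circ> \<sigma> \<circ> w) (2 * i))
          = f (w (\<sigma> (2 * (m - Suc i)))) (w (\<sigma> (2 * (m - Suc i) + 1)))"
        by (simp only: comp_def)
    qed
    also have "\<dots> = (\<Prod>i<m. f (w (\<sigma> (2 * i))) (w (\<sigma> (2 * i + 1))))"
      by (rule prod.nat_diff_reindex)
    finally show "pf_term m (\<lambda>i j. f j i) (w \<circ> \<sigma> \<circ> w) = pf_term m (\<lambda>i j. f (w i) (w j)) \<sigma>"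
      unfolding pf_term_def sgn by simp
  qed (auto simp: fun_eq_iff ww intro!: permutes_compose w)
  finally show ?thesis .
qed

lemma sub_pf_image_decreasing:
  assumes C: "finite C" and \<nu>: "\<And>x y. x \<in> C \<Longrightarrow> y \<in> C \<Longrightarrow> x < y \<Longrightarrow> \<nu> y < \<nu> x"
  shows "sub_pf f (\<nu> ` C) = sub_pf (\<lambda>i j. f (\<nu> j) (\<nu> i)) C"
proof -
  have inj: "inj_on \<nu> C"
    by (rule inj_onI) (metis \<nu> less_irrefl linorder_neqE_nat)
  then have card: "card (\<nu> ` C) = card C" by (rule card_image)
  show ?thesis
  proof (cases "even (card C)")
    case True
    then obtain m where m: "card C = 2 * m" by (rule evenE)
    have "pf_sum m (\<lambda>i j. f (pick (\<nu> ` C) i) (pick (\<nu> ` C) j))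
        = pf_sum m (\<lambda>i j. (\<lambda>i j. f (\<nu> (pick C i)) (\<nu> (pick C j))) (2 * m - 1 - i) (2 * m - 1 - j))"
      by (intro pf_sum_cong) (simp add: pick_image_decreasing[OF C \<nu>] m)
    also have "\<dots> = pf_sum m (\<lambda>i j. f (\<nu> (pick C j)) (\<nu> (pick C i)))"
      by (rule pf_sum_reverse)
    finally show ?thesis by (simp add: sub_pf_even[OF m] sub_pf_even[OF trans[OF card m]])
  qed (simp add: sub_pf_def card)
qed

section \<open>The sum over subsets and its recursion\<close>

lemma sum_Pow_insert:
  fixes h :: "'a set \<Rightarrow> 'b::comm_monoid_add"
  assumes "finite R" "r \<notin> R"
  shows "(\<Sum>I\<in>Pow (insert r R). h I) = (\<Sum>I\<in>Pow R. h I) + (\<Sum>I\<in>Pow R. h (insert r I))"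
proof -
  have "inj_on (insert r) (Pow R)"
    using assms(2) by (auto intro!: inj_onI)
  moreover have "Pow R \<inter> insert r ` Pow R = {}" using assms(2) by auto
  ultimately show ?thesis
    using assms(1) by (simp add: Pow_insert sum.union_disjoint sum.reindex)
qed

lemma sum_Pow_member:
  fixes h :: "'a set \<Rightarrow> 'a \<Rightarrow> 'b::comm_monoid_add"
  assumes "finite S"
  shows "(\<Sum>I\<in>Pow S. \<Sum>y\<in>I. h I y) = (\<Sum>y\<in>S. \<Sum>I\<in>Pow (S - {y}). h (insert y I) y)"
proof -
  have "(\<Sum>I\<in>Pow S. \<Sum>y\<in>I. h I y) = (\<Sum>(I, y)\<in>Sigma (Pow S) (\<lambda>I. I). h I y)"
    using assms by (intro sum.Sigma) (auto intro: finite_subset)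
  also have "\<dots> = (\<Sum>(y, I)\<in>Sigma S (\<lambda>y. Pow (S - {y})). h (insert y I) y)"
    by (rule sum.reindex_bij_witness[where i = "\<lambda>(y, I). (insert y I, y)" and j = "\<lambda>(I, y). (y, I - {y})"])
      (auto simp: insert_absorb)
  also have "\<dots> = (\<Sum>y\<in>S. \<Sum>I\<in>Pow (S - {y}). h (insert y I) y)"
    using assms by (intro sum.Sigma[symmetric]) auto
  finally show ?thesis .
qed

lemma sum_Pow_nonmember:
  fixes h :: "'a set \<Rightarrow> 'a \<Rightarrow> 'b::comm_monoid_add"
  assumes "finite C"
  shows "(\<Sum>J\<in>Pow C. \<Sum>c\<in>C - J. h J c) = (\<Sum>c\<in>C. \<Sum>J\<in>Pow (C - {c}). h J c)"
proof -
  have "(\<Sum>J\<in>Pow C. \<Sum>c\<in>C - J. h J c) = (\<Sum>(J, c)\<in>Sigma (Pow C) (\<lambda>J. C - J). h J c)"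
    using assms by (intro sum.Sigma) auto
  also have "\<dots> = (\<Sum>(c, J)\<in>Sigma C (\<lambda>c. Pow (C - {c})). h J c)"
    by (rule sum.reindex_bij_witness[where i = "\<lambda>(c, J). (J, c)" and j = "\<lambda>(J, c). (c, J)"]) auto
  also have "\<dots> = (\<Sum>c\<in>C. \<Sum>J\<in>Pow (C - {c}). h J c)"
    using assms by (intro sum.Sigma[symmetric]) auto
  finally show ?thesis .
qed

text \<open>
  The inner sum of the expansion, over the subsets \<open>J\<close> of the column set \<open>C\<close>, for a fixed set \<open>Q\<close> of rows
  used by the minor. Subsets for which the minor is not square or \<open>J\<close> is odd contribute 0.
\<close>
definition det_pf_sum ::
  "(nat \<Rightarrow> nat \<Rightarrow> complex) \<Rightarrow> (nat \<Rightarrow> nat \<Rightarrow> complex) \<Rightarrow> nat set \<Rightarrow> nat set \<Rightarrow> complex" where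
  "det_pf_sum d g Q C = (\<Sum>J\<in>Pow C. cross_sign (C - J) J * sub_det d Q (C - J) * sub_pf g J)"

text \<open>
  The full sum over the subsets \<open>I\<close> of the row set \<open>R\<close> and \<open>J\<close> of the column set \<open>C\<close>, for arbitrary arrays
  \<open>f\<close>, \<open>d\<close>, \<open>g\<close> in the roles of \<open>b\<close>, \<open>a\<close>, \<open>c\<close>.
\<close>
definition pf_det_pf_sum ::
  "(nat \<Rightarrow> nat \<Rightarrow> complex) \<Rightarrow> (nat \<Rightarrow> nat \<Rightarrow> complex) \<Rightarrow> (nat \<Rightarrow> nat \<Rightarrow> complex) \<Rightarrow>
    nat set \<Rightarrow> nat set \<Rightarrow> complex" where
  "pf_det_pf_sum f d g R C = (\<Sum>I\<in>Pow R. cross_sign (R - I) I * sub_pf f I * det_pf_sum d g (R - I) C)"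

lemma det_pf_sum_expand:
  assumes Q: "finite Q" "\<And>x. x \<in> Q \<Longrightarrow> r < x" and C: "finite C"
  shows "det_pf_sum d g (insert r Q) C
    = (\<Sum>c\<in>C. rank_sign C c * d r c * det_pf_sum d g Q (C - {c}))"
proof -
  let ?h = "\<lambda>J c. rank_sign C c * d r c *
    (cross_sign (C - {c} - J) J * sub_det d Q (C - {c} - J) * sub_pf g J)"
  have "det_pf_sum d g (insert r Q) C = (\<Sum>J\<in>Pow C. \<Sum>c\<in>C - J. ?h J c)"
    unfolding det_pf_sum_def
  proof (rule sum.cong[OF refl])
    fix J assume "J \<in> Pow C"
    then have J: "J \<subseteq> C" "finite J" using C by (auto intro: finite_subset)
    have eq: "cross_sign (C - J) J * (rank_sign (C - J) c * d r c * sub_det d Q (C - J - {c})) * sub_pf g J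
        = ?h J c" if "c \<in> C - J" for c
    proof -
      have "C - J = insert c (C - {c} - J)" using that by auto
      then have "cross_sign (C - J) J = rank_sign J c * cross_sign (C - {c} - J) J"
        using C cross_sign_insert_left[of "C - {c} - J" c J] by auto
      moreover have "rank_sign C c = rank_sign (C - J) c * rank_sign J c"
        using rank_sign_union[of "C - J" J c] C J by (simp add: Un_absorb2 Int_commute)
      moreover have "C - J - {c} = C - {c} - J" by auto
      ultimately show ?thesis by (simp add: mult_ac)
    qed
    have "sub_det d (insert r Q) (C - J)
        = (\<Sum>c\<in>C - J. rank_sign (C - J) c * d r c * sub_det d Q (C - J - {c}))"
      using Q C by (intro sub_det_expand) auto
    then show "cross_sign (C - J) J * sub_det d (insert r Q) (C - J) * sub_pf g J = (\<Sum>c\<in>C - J. ?h J c)"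
      by (simp only: sum_distrib_left sum_distrib_right eq cong: sum.cong)
  qed
  also have "\<dots> = (\<Sum>c\<in>C. \<Sum>J\<in>Pow (C - {c}). ?h J c)"
    by (rule sum_Pow_nonmember[OF C])
  finally show ?thesis
    by (simp add: det_pf_sum_def sum_distrib_left)
qed

text \<open>
  The recursion that matches the expansion of the Pfaffian of the whole matrix. If the smallest row \<open>r\<close>
  lies in \<open>I\<close>, the Pfaffian over \<open>I\<close> is expanded along \<open>r\<close>, which gives the first sum; otherwise the minor is
  expanded along its row \<open>r\<close>, which gives the second.
\<close>
lemma pf_det_pf_sum_expand:
  assumes f: "\<And>i j. f j i = - f i j"
    and R: "finite R" "\<And>x. x \<in> R \<Longrightarrow> r < x" and C: "finite C"
  shows "pf_det_pf_sum f d g (insert r R) C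
    = (\<Sum>y\<in>R. rank_sign R y * f r y * pf_det_pf_sum f d g (R - {y}) C)
    + (\<Sum>c\<in>C. rank_sign C c * d r c * pf_det_pf_sum f d g R (C - {c}))"
proof -
  have r: "r \<notin> R" using R(2) by auto
  let ?t = "\<lambda>I. cross_sign (insert r R - I) I * sub_pf f I * det_pf_sum d g (insert r R - I) C"
  have r_out: "?t I = (\<Sum>c\<in>C. rank_sign C c * d r c *
      (cross_sign (R - I) I * sub_pf f I * det_pf_sum d g (R - I) (C - {c})))"
    if I: "I \<in> Pow R" for I
  proof -
    have *: "insert r R - I = insert r (R - I)" using I r by auto
    have "rank_sign I r = 1" using I R(2) by (intro rank_sign_lower) auto
    then have "cross_sign (insert r (R - I)) I = cross_sign (R - I) I"
      using R r by (simp add: cross_sign_insert_left)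
    moreover have "det_pf_sum d g (insert r (R - I)) C
        = (\<Sum>c\<in>C. rank_sign C c * d r c * det_pf_sum d g (R - I) (C - {c}))"
      using R C by (intro det_pf_sum_expand) auto
    ultimately show ?thesis
      unfolding * by (simp add: sum_distrib_left mult_ac)
  qed
  let ?h = "\<lambda>I y. rank_sign R y * f r y *
      (cross_sign (R - I) (I - {y}) * sub_pf f (I - {y}) * det_pf_sum d g (R - I) C)"
  have r_in: "?t (insert r I) = (\<Sum>y\<in>I. ?h I y)" if I: "I \<in> Pow R" for I
  proof -
    have fin: "finite I" using I R(1) by (auto intro: finite_subset)
    have *: "insert r R - insert r I = R - I" using r by auto
    have pf: "sub_pf f (insert r I) = (\<Sum>y\<in>I. rank_sign I y * f r y * sub_pf f (I - {y}))"
      using I R(2) fin by (intro sub_pf_expand[OF f]) auto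
    have eq: "cross_sign (R - I) (insert r I) * (rank_sign I y * f r y * sub_pf f (I - {y})) *
        det_pf_sum d g (R - I) C = ?h I y" if y: "y \<in> I" for y
    proof -
      have I': "insert r I = insert r (insert y (I - {y}))" using y by auto
      have "cross_sign (R - I) (insert r I) = cross_sign (R - I) (I - {y}) * rank_sign (R - I) y"
        unfolding I' using I R y r fin by (intro cross_sign_insert_two_right) auto
      moreover have "rank_sign R y = rank_sign (R - I) y * rank_sign I y"
        using rank_sign_union[of "R - I" I y] I R fin by (simp add: Un_absorb2 Int_commute)
      ultimately show ?thesis by (simp add: mult_ac)
    qed
    show ?thesis
      unfolding * pf by (simp only: sum_distrib_left sum_distrib_right eq cong: sum.cong)
  qed
  have "pf_det_pf_sum f d g (insert r R) C = (\<Sum>I\<in>Pow R. ?t I) + (\<Sum>I\<in>Pow R. ?t (insert r I))"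
    unfolding pf_det_pf_sum_def by (rule sum_Pow_insert[OF R(1) r])
  also have "(\<Sum>I\<in>Pow R. ?t I) = (\<Sum>c\<in>C. rank_sign C c * d r c * pf_det_pf_sum f d g R (C - {c}))"
    unfolding pf_det_pf_sum_def sum_distrib_left
    by (subst sum.swap) (intro sum.cong refl r_out)
  also have "(\<Sum>I\<in>Pow R. ?t (insert r I)) = (\<Sum>I\<in>Pow R. \<Sum>y\<in>I. ?h I y)"
    by (intro sum.cong refl r_in)
  also have "\<dots> = (\<Sum>y\<in>R. \<Sum>I\<in>Pow (R - {y}). ?h (insert y I) y)"
    by (rule sum_Pow_member[OF R(1)])
  also have "\<dots> = (\<Sum>y\<in>R. rank_sign R y * f r y * pf_det_pf_sum f d g (R - {y}) C)"
    unfolding pf_det_pf_sum_def sum_distrib_left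
  proof (intro sum.cong refl)
    fix y I assume "I \<in> Pow (R - {y})"
    then have "insert y I - {y} = I" by auto
    moreover have "R - insert y I = R - {y} - I" by auto
    ultimately show "?h (insert y I) y = rank_sign R y * f r y *
        (cross_sign (R - {y} - I) I * sub_pf f I * det_pf_sum d g (R - {y} - I) C)"
      by simp
  qed
  finally show ?thesis by (simp add: add.commute)
qed

lemma pf_det_pf_sum_empty:
  assumes "finite C"
  shows "pf_det_pf_sum f d g {} C = sub_pf g C"
proof -
  have "cross_sign (C - J) J * sub_det d {} (C - J) * sub_pf g J = (if J = C then sub_pf g C else 0)"
    if "J \<in> Pow C" for J
  proof (cases "J = C")
    case False
    then have "card (C - J) \<noteq> 0" using that assms by auto
    then have "sub_det d {} (C - J) = 0" by (simp add: sub_det_def)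
    then show ?thesis using False by simp
  qed simp
  then have "det_pf_sum d g {} C = (\<Sum>J\<in>Pow C. if J = C then sub_pf g C else 0)"
    unfolding det_pf_sum_def by (intro sum.cong refl)
  then show ?thesis
    using assms by (simp add: pf_det_pf_sum_def)
qed

section \<open>The block expansion\<close>

text \<open>
  Here the row indices come first and the columns \<open>C\<close> are embedded above them in decreasing order by \<open>\<nu>\<close>,
  as \<open>i \<mapsto> -i\<close> does. Since \<open>card R + card C\<close> is even, the reversal makes the sign of a column
  in the expansion of the Pfaffian equal to its sign in the expansion of the minor.
\<close>
theorem sub_pf_block_expansion:
  assumes f: "\<And>i j. f j i = - f i j"
    and "finite R" "finite C" "even (card R + card C)"
    and "\<And>x y. x \<in> C \<Longrightarrow> y \<in> C \<Longrightarrow> x < y \<Longrightarrow> \<nu> y < \<nu> x"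
    and "\<And>r c. r \<in> R \<Longrightarrow> c \<in> C \<Longrightarrow> r < \<nu> c"
  shows "sub_pf f (R \<union> \<nu> ` C)
    = pf_det_pf_sum f (\<lambda>i c. f i (\<nu> c)) (\<lambda>c c'. f (\<nu> c') (\<nu> c)) R C"
  using assms(2-)
proof (induction "card R" arbitrary: R C rule: less_induct)
  case less
  let ?d = "\<lambda>i c. f i (\<nu> c)" and ?g = "\<lambda>c c'. f (\<nu> c') (\<nu> c)"
  let ?B = "pf_det_pf_sum f ?d ?g"
  note C = \<open>finite C\<close> and \<nu> = less.prems(4) and below = less.prems(5)
  show ?case
  proof (cases "R = {}")
    case True
    then show ?thesis
      by (simp add: pf_det_pf_sum_empty[OF C] sub_pf_image_decreasing[OF C \<nu>])
  next
    case False
    define r where "r = Min R"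
    define S where "S = R - {r}"
    have r: "r \<in> R" and R: "R = insert r S" "r \<notin> S" and S: "finite S"
      using Min_in[OF \<open>finite R\<close> False] \<open>finite R\<close> by (auto simp: r_def S_def)
    have rS: "r < x" if "x \<in> S" for x
      using that \<open>finite R\<close> by (auto simp: S_def r_def intro!: order.not_eq_order_implies_strict)
    have cardR: "card R = Suc (card S)" using R S by simp
    have inj: "inj_on \<nu> C"
      by (rule inj_onI) (metis \<nu> less_irrefl linorder_neqE_nat)
    have disj: "S \<inter> \<nu> ` C = {}" using below R by fastforce
    have rank_S: "rank_sign (S \<union> \<nu> ` C) y = rank_sign S y" if "y \<in> S" for y
    proof -
      have "rank_sign (\<nu> ` C) y = 1"
        using below R that by (intro rank_sign_lower) auto
      then show ?thesis using rank_sign_union[OF S _ disj] C by simp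
    qed
    have rank_C: "rank_sign (S \<union> \<nu> ` C) (\<nu> c) = rank_sign C c" if c: "c \<in> C" for c
    proof -
      have iff: "\<nu> a < \<nu> c \<longleftrightarrow> c < a" if "a \<in> C" for a
        using \<nu>[of a c] \<nu>[of c a] c that by (metis less_asym less_irrefl linorder_neqE_nat)
      have "{a \<in> \<nu> ` C. a < \<nu> c} = \<nu> ` {a \<in> C. c < a}" using iff by auto
      then have "card {a \<in> \<nu> ` C. a < \<nu> c} = card {a \<in> C. c < a}"
        using inj by (simp add: card_image inj_on_subset)
      then have "rank_sign (\<nu> ` C) (\<nu> c) = (-1) ^ card {a \<in> C. c < a}"
        by (simp add: rank_sign_def)
      moreover have "rank_sign S (\<nu> c) = (-1) ^ card S"
        using below R c by (intro rank_sign_upper) auto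
      ultimately have 1: "rank_sign (S \<union> \<nu> ` C) (\<nu> c) = (-1) ^ (card S + card {a \<in> C. c < a})"
        using rank_sign_union[OF S _ disj] C by (simp add: power_add)
      \<comment> \<open>The elements of \<open>S\<close> together with those of \<open>C\<close> above \<open>c\<close> have the same parity as the elements of
        \<open>C\<close> below \<open>c\<close>, because \<open>S\<close> and \<open>C - {c}\<close> have an even number of elements in total.\<close>
      have "C = {a \<in> C. a < c} \<union> {c} \<union> {a \<in> C. c < a}" using c by auto
      then have "card C = card ({a \<in> C. a < c} \<union> {c} \<union> {a \<in> C. c < a})" by simp
      also have "\<dots> = card {a \<in> C. a < c} + 1 + card {a \<in> C. c < a}"
        using C by (subst card_Un_disjoint; (subst card_Un_disjoint)?) auto
      finally have "even (card S + card {a \<in> C. c < a}) \<longleftrightarrow> even (card {a \<in> C. a < c})"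
        using \<open>even (card R + card C)\<close> cardR by auto
      then show ?thesis unfolding 1 by (simp add: rank_sign_def minus_one_power_iff)
    qed
    have IH_S: "sub_pf f (S \<union> \<nu> ` C - {y}) = ?B (S - {y}) C" if y: "y \<in> S" for y
    proof -
      have cS: "card S = Suc (card (S - {y}))" using S y by (rule card.remove)
      have "S \<union> \<nu> ` C - {y} = (S - {y}) \<union> \<nu> ` C" using y disj by auto
      moreover have "sub_pf f ((S - {y}) \<union> \<nu> ` C) = ?B (S - {y}) C"
      proof (rule less.hyps)
        show "even (card (S - {y}) + card C)"
          using \<open>even (card R + card C)\<close> cardR cS by simp
      qed (use cardR cS S C \<nu> below R in auto)
      ultimately show ?thesis by simp
    qed
    have IH_C: "sub_pf f (S \<union> \<nu> ` C - {\<nu> c}) = ?B S (C - {c})" if c: "c \<in> C" for c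
    proof -
      have cC: "card C = Suc (card (C - {c}))" using C c by (rule card.remove)
      have "\<nu> ` C - {\<nu> c} = \<nu> ` (C - {c})" using inj c by (auto simp: inj_on_def)
      then have "S \<union> \<nu> ` C - {\<nu> c} = S \<union> \<nu> ` (C - {c})" using c disj by auto
      moreover have "sub_pf f (S \<union> \<nu> ` (C - {c})) = ?B S (C - {c})"
      proof (rule less.hyps)
        show "even (card S + card (C - {c}))"
          using \<open>even (card R + card C)\<close> cardR cC by simp
      qed (use cardR S C \<nu> below R in auto)
      ultimately show ?thesis by simp
    qed
    have "sub_pf f (R \<union> \<nu> ` C) = sub_pf f (insert r (S \<union> \<nu> ` C))"
      by (simp add: R)
    also have "\<dots> = (\<Sum>y\<in>S \<union> \<nu> ` C. rank_sign (S \<union> \<nu> ` C) y * f r y * sub_pf f (S \<union> \<nu> ` C - {y}))"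
      using S C rS below r by (intro sub_pf_expand[OF f]) auto
    also have "\<dots> = (\<Sum>y\<in>S. rank_sign (S \<union> \<nu> ` C) y * f r y * sub_pf f (S \<union> \<nu> ` C - {y}))
       + (\<Sum>c\<in>C. rank_sign (S \<union> \<nu> ` C) (\<nu> c) * f r (\<nu> c) * sub_pf f (S \<union> \<nu> ` C - {\<nu> c}))"
      using S C disj by (simp add: sum.union_disjoint sum.reindex[OF inj])
    also have "\<dots> = (\<Sum>y\<in>S. rank_sign S y * f r y * ?B (S - {y}) C)
       + (\<Sum>c\<in>C. rank_sign C c * f r (\<nu> c) * ?B S (C - {c}))"
      by (intro arg_cong2[of _ _ _ _ "(+)"] sum.cong refl) (simp_all only: rank_S rank_C IH_S IH_C)
    also have "\<dots> = ?B R C"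
      unfolding R(1) using pf_det_pf_sum_expand[OF f S rS C, where d = ?d and g = ?g] by simp
    finally show ?thesis .
  qed
qed

section \<open>Shuffle signs count inversions\<close>

text \<open>
  By induction on \<open>n\<close>, removing the largest point. If it lies in \<open>B\<close> it is fixed and creates no inversion; if
  it lies in \<open>A\<close> it is inserted at position \<open>card A - 1\<close> and is inverted with every element of \<open>B\<close>.
\<close>
lemma one_line_shuffle_permutes_sign:
  fixes A B :: "nat set"
  assumes "A \<union> B = {..<n}" "A \<inter> B = {}"
  defines "w \<equiv> \<lambda>A B k. if k < card A + card B
    then (sorted_list_of_set A @ sorted_list_of_set B) ! k else k"
  shows "w A B permutes {0..<n} \<and> of_int (sign (w A B)) = cross_sign A B"
  using assms(1,2)
proof (induction n arbitrary: A B)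
  case 0
  then have "A = {}" "B = {}" by auto
  moreover have "w {} {} = id" by (simp add: w_def id_def)
  ultimately show ?case by (simp add: id_def)
next
  case (Suc n)
  have fin: "finite A" "finite B" using finite_lessThan[of "Suc n"] Suc.prems(1) by (metis finite_Un)+
  have card: "card A + card B = Suc n"
    using card_Un_disjoint[OF fin Suc.prems(2)] Suc.prems(1) by simp
  have top: "sorted_list_of_set (insert n S) = sorted_list_of_set S @ [n]" if "S \<subseteq> {..<n}" for S
  proof -
    have "finite S" using that by (rule finite_subset) simp
    then have "sorted (sorted_list_of_set S @ [n])" "distinct (sorted_list_of_set S @ [n])"
      "set (sorted_list_of_set S @ [n]) = insert n S"
      using that by (auto simp: sorted_append)
    then show ?thesis by (metis sorted_list_of_set.idem_if_sorted_distinct)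
  qed
  show ?case
  proof (cases "n \<in> B")
    case True
    define B' where "B' = B - {n}"
    have B: "B = insert n B'" "n \<notin> B'" using True by (auto simp: B'_def)
    have "A \<union> B' = A \<union> B - {n}" using Suc.prems(2) True by (auto simp: B'_def)
    also have "\<dots> = {..<n}" unfolding Suc.prems(1) by auto
    finally have AB': "A \<union> B' = {..<n}" "A \<inter> B' = {}" using Suc.prems(2) B'_def by blast+
    have fin': "finite B'" using fin by (simp add: B'_def)
    have card': "card A + card B' = n" using card B fin' by simp
    have "w A B = w A B'"
    proof
      fix k
      have "sorted_list_of_set B = sorted_list_of_set B' @ [n]"
        unfolding B(1) by (rule top) (use AB' in auto)
      then show "w A B k = w A B' k"
        using card card' by (auto simp: w_def nth_append)
    qed
    moreover have "w A B' permutes {0..<n}" "of_int (sign (w A B')) = cross_sign A B'"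
      using Suc.IH[OF AB'] by auto
    moreover have "cross_sign A B = cross_sign A B'"
      unfolding cross_sign_def
    proof (rule prod.cong[OF refl])
      fix x assume "x \<in> A"
      then have "x < n" using AB' by auto
      then show "rank_sign B x = rank_sign B' x" using B fin' by (simp add: rank_sign_prod)
    qed
    ultimately show ?thesis by (auto intro: permutes_subset)
  next
    case False
    then have nA: "n \<in> A" using Suc.prems(1) by auto
    define A' where "A' = A - {n}"
    have A: "A = insert n A'" "n \<notin> A'" using nA by (auto simp: A'_def)
    have "A' \<union> B = A \<union> B - {n}" using False by (auto simp: A'_def)
    also have "\<dots> = {..<n}" unfolding Suc.prems(1) by auto
    finally have AB': "A' \<union> B = {..<n}" "A' \<inter> B = {}" using Suc.prems(2) A'_def by blast+
    have fin': "finite A'" using fin by (simp add: A'_def)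
    have card': "card A' + card B = n" "card A = Suc (card A')" using card A fin' by simp_all
    have IH: "w A' B permutes {0..<n}" "of_int (sign (w A' B)) = cross_sign A' B"
      using Suc.IH[OF AB'] by auto
    have less: "w A' B k < n" if "k < n" for k
      using permutes_in_image[OF IH(1), of k] that by simp
    have eq: "w A B = permutation_insert (card A') n (w A' B)"
    proof
      fix k
      have sl: "sorted_list_of_set A = sorted_list_of_set A' @ [n]"
        unfolding A(1) by (rule top) (use AB' in auto)
      consider "k < card A'" | "k = card A'" | "k > card A'" "k < Suc n" | "k \<ge> Suc n" by linarith
      then show "w A B k = permutation_insert (card A') n (w A' B) k"
      proof cases
        case 1
        then show ?thesis
          using less[of k] card' sl by (simp add: permutation_insert_expand) (simp add: w_def nth_append)
      next
        case 2
        then show ?thesis using card' sl by (simp add: w_def nth_append)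
      next
        case 3
        then have "w A B k = w A' B (k - 1)"
          using card' sl by (auto simp: w_def nth_append)
        then show ?thesis
          using less[of "k - 1"] 3 by (simp add: permutation_insert_expand)
      next
        case 4
        then show ?thesis
          using card' by (auto simp: permutation_insert_expand w_def)
      qed
    qed
    have le: "card A' < Suc n" using card' by simp
    have "of_int (sign (w A B)) = (-1) ^ (card A' + n) * cross_sign A' B"
      unfolding eq using signof_permutation_insert[OF IH(1) le, of n, where 'a = complex] IH(2) by simp
    also have "(-1) ^ (card A' + n) = ((-1) ^ card B :: complex)"
      unfolding card'(1)[symmetric] by (simp add: power_add)
    also have "\<dots> = rank_sign B n"
      using AB' by (intro rank_sign_upper[symmetric]) auto
    also have "rank_sign B n * cross_sign A' B = cross_sign A B"
      unfolding A(1) using A fin' by (simp add: cross_sign_insert_left)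
    finally show ?thesis
      unfolding eq using permutation_insert_permutes[OF IH(1) le, of n] by simp
  qed
qed

lemma shuffle_sign_eq_cross_sign:
  assumes "A \<union> B = {..<n}" "A \<inter> B = {}"
  shows "of_int (shuffle_sign A B) = cross_sign A B"
  using one_line_shuffle_permutes_sign[OF assms] by (simp add: shuffle_sign_def)

section \<open>Matrices in the orthogonal Lie algebra\<close>

lemma submatrix_subset:
  assumes "A \<in> carrier_mat n n" "R \<subseteq> {..<n}" "C \<subseteq> {..<n}"
  shows "submatrix A R C = mat (card R) (card C) (\<lambda>(i, j). A $$ (pick R i, pick C j))"
proof -
  have "{i. i < n \<and> i \<in> R} = R" "{j. j < n \<and> j \<in> C} = C" using assms by auto
  then show ?thesis using assms(1) by (simp add: submatrix_def)
qed

lemma mult_exchange_mat: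
  assumes "A \<in> carrier_mat N N" "i < N" "j < N"
  shows "(A * exchange_mat N) $$ (i, j) = A $$ (i, N - 1 - j)"
proof -
  have "(A * exchange_mat N) $$ (i, j) =
      (\<Sum>k\<in>{0..<N}. A $$ (i, k) * (if k + j + 1 = N then 1 else 0))"
    using assms by (simp add: exchange_mat_def scalar_prod_def)
  also have "\<dots> = (\<Sum>k\<in>{0..<N}. if k = N - 1 - j then A $$ (i, k) else 0)"
    using assms by (intro sum.cong) auto
  finally show ?thesis using assms by simp
qed

lemma exchange_mat_mult:
  assumes "A \<in> carrier_mat N N" "i < N" "j < N"
  shows "(exchange_mat N * A) $$ (i, j) = A $$ (N - 1 - i, j)"
proof -
  have "(exchange_mat N * A) $$ (i, j) =
      (\<Sum>k\<in>{0..<N}. (if i + k + 1 = N then 1 else 0) * A $$ (k, j))"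
    using assms by (simp add: exchange_mat_def scalar_prod_def)
  also have "\<dots> = (\<Sum>k\<in>{0..<N}. if k = N - 1 - i then A $$ (k, j) else 0)"
    using assms by (intro sum.cong) auto
  finally show ?thesis using assms by simp
qed

text \<open>
  The defining relation in coordinates: it says that the matrix with entries \<open>X\<^bsub>i,-j\<^esub>\<close> is alternating.
\<close>
lemma orthogonal_lie_algebra_skew:
  assumes X: "X \<in> orthogonal_lie_algebra N" and ij: "i < N" "j < N"
  shows "X $$ (N - 1 - j, i) + X $$ (N - 1 - i, j) = 0"
proof -
  have dim: "X \<in> carrier_mat N N" "exchange_mat N \<in> carrier_mat N N"
    using X by (simp_all add: orthogonal_lie_algebra_def exchange_mat_def)
  have "0 = (transpose_mat X * exchange_mat N + exchange_mat N * X) $$ (i, j)"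
    using X ij by (simp add: orthogonal_lie_algebra_def)
  also have "\<dots> = (transpose_mat X * exchange_mat N) $$ (i, j) + (exchange_mat N * X) $$ (i, j)"
    using ij dim by (intro index_add_mat) auto
  finally show ?thesis
    using ij dim mult_exchange_mat[of "transpose_mat X" N i j] exchange_mat_mult[of X N i j] by simp
qed

theorem corollary3p4:
  fixes n :: nat and X a b c :: "complex mat"
  assumes "n > 0"
    and "X \<in> orthogonal_lie_algebra (2 * n)"
    and "a \<in> carrier_mat n n" "b \<in> carrier_mat n n" "c \<in> carrier_mat n n"
    and "X = four_block_mat a b c (- (exchange_mat n * transpose_mat a * exchange_mat n))"
  shows "orthogonal_pfaffian X =
    (\<Sum>k = 0..n div 2.
      \<Sum>I | I \<subseteq> {..<n} \<and> card I = 2 * k.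
        \<Sum>J | J \<subseteq> {..<n} \<and> card J = 2 * k.
          of_int (shuffle_sign ({..<n} - I) I) * of_int (shuffle_sign ({..<n} - J) J)
          * det (submatrix a ({..<n} - I) ({..<n} - J))
          * pfaffian (submatrix (b_array n X) I I)
          * pfaffian (submatrix (c_array n X) J J))"
proof -
  let ?U = "{..<n}" and ?J = "exchange_mat (2 * n)"
  have X: "X \<in> carrier_mat (2 * n) (2 * n)"
    using assms(2) by (simp add: orthogonal_lie_algebra_def)
  have ex: "?J \<in> carrier_mat (2 * n) (2 * n)" by (simp add: exchange_mat_def)
  \<comment> \<open>The entries of \<open>X J\<^bsub>2n\<^esub>\<close>, extended by 0 so that \<open>f\<close> is antisymmetric on all indices.\<close>
  define f where "f = (\<lambda>i j. if i < 2 * n \<and> j < 2 * n then X $$ (i, 2 * n - 1 - j) else 0)"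
  define \<nu> where "\<nu> = (\<lambda>i. 2 * n - 1 - i)"
  let ?d = "\<lambda>i j. f i (\<nu> j)" and ?g = "\<lambda>i j. f (\<nu> j) (\<nu> i)"
  define t where "t = (\<lambda>I J. cross_sign (?U - I) I * cross_sign (?U - J) J *
      sub_det ?d (?U - I) (?U - J) * sub_pf f I * sub_pf ?g J)"
  have f: "f j i = - f i j" for i j
  proof (cases "i < 2 * n \<and> j < 2 * n")
    case True
    then have "2 * n - 1 - (2 * n - 1 - i) = i" "2 * n - 1 - (2 * n - 1 - j) = j" by auto
    with True show ?thesis
      using orthogonal_lie_algebra_skew[OF assms(2), of "2 * n - 1 - i" "2 * n - 1 - j"]
      by (simp add: f_def add_eq_0_iff2)
  qed (auto simp: f_def)
  have "orthogonal_pfaffian X = sub_pf f {..<2 * n}"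
  proof -
    have "X * exchange_mat (dim_row X)
        = mat (2 * n) (2 * n) (\<lambda>(i, j). f (pick {..<2 * n} i) (pick {..<2 * n} j))"
      using X ex mult_exchange_mat[OF X] by (intro eq_matI) (auto simp: f_def pick_lessThan)
    then show ?thesis by (simp add: orthogonal_pfaffian_def sub_pf_def)
  qed
  also have "{..<2 * n} = ?U \<union> \<nu> ` ?U"
  proof -
    have "x \<in> \<nu> ` ?U" if "x < 2 * n" "\<not> x < n" for x
      using that by (intro image_eqI[of _ _ "2 * n - 1 - x"]) (auto simp: \<nu>_def)
    then show ?thesis by (auto simp: \<nu>_def)
  qed
  also have "sub_pf f (?U \<union> \<nu> ` ?U) = pf_det_pf_sum f ?d ?g ?U ?U"
    by (rule sub_pf_block_expansion[OF f]) (auto simp: \<nu>_def)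
  also have "\<dots> = (\<Sum>I\<in>Pow ?U. \<Sum>J\<in>Pow ?U. t I J)"
    by (simp add: t_def pf_det_pf_sum_def det_pf_sum_def sum_distrib_left mult_ac)
  finally have *: "orthogonal_pfaffian X = (\<Sum>I\<in>Pow ?U. \<Sum>J\<in>Pow ?U. t I J)" .
  have fin: "finite I" if "I \<subseteq> ?U" for I using that by (rule finite_subset) simp
  have card_le: "card I \<le> n" if "I \<subseteq> ?U" for I
    using card_mono[OF _ that] by simp
  \<comment> \<open>Only pairs of subsets of the same even size contribute.\<close>
  have zero: "t I J = 0" if "I \<subseteq> ?U" "J \<subseteq> ?U" "odd (card I) \<or> card I \<noteq> card J" for I J
  proof (cases "even (card I)")
    case True
    then have "card (?U - I) \<noteq> card (?U - J)"
      using that fin card_le[of I] card_le[of J] by (auto simp: card_Diff_subset)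
    then show ?thesis by (simp add: t_def sub_det_def)
  qed (simp add: t_def sub_pf_def)
  have X_a: "a $$ (i, j) = f i (\<nu> j)" if "i < n" "j < n" for i j
  proof -
    have "a $$ (i, j) = X $$ (i, j)"
      using that assms(3-5) by (simp add: assms(6) index_mat_four_block(1))
    then show ?thesis using that by (simp add: f_def \<nu>_def)
  qed
  have pick_lt: "pick S i < n" if "S \<subseteq> ?U" "i < card S" for S i
    using pick_in_set_le[OF that(2)] that(1) by auto
  have term_eq: "t I J = of_int (shuffle_sign (?U - I) I) * of_int (shuffle_sign (?U - J) J)
          * det (submatrix a (?U - I) (?U - J))
          * pfaffian (submatrix (b_array n X) I I)
          * pfaffian (submatrix (c_array n X) J J)"
    if I: "I \<subseteq> ?U" "card I = 2 * k" and J: "J \<subseteq> ?U" "card J = 2 * k" for I J k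
  proof -
    have "cross_sign (?U - S) S = of_int (shuffle_sign (?U - S) S)" if "S \<subseteq> ?U" for S
      using that by (intro shuffle_sign_eq_cross_sign[symmetric]) auto
    moreover have "sub_det ?d (?U - I) (?U - J) = det (submatrix a (?U - I) (?U - J))"
    proof -
      have "card (?U - I) = card (?U - J)" using I J fin by (simp add: card_Diff_subset)
      moreover have "mat (card (?U - I)) (card (?U - J)) (\<lambda>(i, j). f (pick (?U - I) i) (\<nu> (pick (?U - J) j)))
          = submatrix a (?U - I) (?U - J)"
        unfolding submatrix_subset[OF assms(3) Diff_subset Diff_subset]
        by (intro eq_matI) (simp_all add: X_a pick_lt del: pick.simps)
      ultimately show ?thesis by (simp add: sub_det_def)
    qed
    moreover have "sub_pf f I = pfaffian (submatrix (b_array n X) I I)"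
    proof -
      have b: "b_array n X \<in> carrier_mat n n" by (simp add: b_array_def)
      have "f i j = b_array n X $$ (i, j)" if "i < n" "j < n" for i j
        using that by (simp add: b_array_def f_def)
      then have "mat (card I) (card I) (\<lambda>(i, j). f (pick I i) (pick I j)) = submatrix (b_array n X) I I"
        unfolding submatrix_subset[OF b I(1) I(1)]
        using pick_lt[OF I(1)] by (intro eq_matI) (simp_all del: pick.simps)
      then show ?thesis using I by (simp add: sub_pf_def)
    qed
    moreover have "sub_pf ?g J = pfaffian (submatrix (c_array n X) J J)"
    proof -
      have c: "c_array n X \<in> carrier_mat n n" by (simp add: c_array_def)
      have "f (\<nu> j) (\<nu> i) = c_array n X $$ (i, j)" if "i < n" "j < n" for i j
        using that by (simp add: c_array_def f_def \<nu>_def)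
      then have "mat (card J) (card J) (\<lambda>(i, j). f (\<nu> (pick J j)) (\<nu> (pick J i))) = submatrix (c_array n X) J J"
        unfolding submatrix_subset[OF c J(1) J(1)]
        using pick_lt[OF J(1)] by (intro eq_matI) (simp_all del: pick.simps)
      then show ?thesis using J by (simp add: sub_pf_def)
    qed
    ultimately show ?thesis using I(1) J(1) by (simp add: t_def)
  qed
  have "orthogonal_pfaffian X = (\<Sum>I\<in>{I. I \<subseteq> ?U \<and> even (card I)}. \<Sum>J\<in>Pow ?U. t I J)"
    unfolding *
  proof (rule sum.mono_neutral_right)
    show "\<forall>I\<in>Pow ?U - {I. I \<subseteq> ?U \<and> even (card I)}. (\<Sum>J\<in>Pow ?U. t I J) = 0"
      using zero by (intro ballI sum.neutral) blast
  qed auto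
  also have "\<dots> = (\<Sum>k = 0..n div 2. \<Sum>I | I \<in> {I. I \<subseteq> ?U \<and> even (card I)} \<and> card I div 2 = k. \<Sum>J\<in>Pow ?U. t I J)"
    using card_le by (intro sum.group[symmetric]) (auto intro!: div_le_mono)
  also have "\<dots> = (\<Sum>k = 0..n div 2. \<Sum>I | I \<subseteq> ?U \<and> card I = 2 * k.
        \<Sum>J | J \<subseteq> ?U \<and> card J = 2 * k. t I J)"
  proof (rule sum.cong[OF refl], rule sum.cong)
    show "{I. I \<in> {I. I \<subseteq> ?U \<and> even (card I)} \<and> card I div 2 = k} = {I. I \<subseteq> ?U \<and> card I = 2 * k}" for k
      by auto
    show "(\<Sum>J\<in>Pow ?U. t I J) = (\<Sum>J | J \<subseteq> ?U \<and> card J = 2 * k. t I J)"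
      if "I \<in> {I. I \<subseteq> ?U \<and> card I = 2 * k}" for k I
      using that by (intro sum.mono_neutral_right) (auto intro!: zero)
  qed
  also have "\<dots> = (\<Sum>k = 0..n div 2. \<Sum>I | I \<subseteq> ?U \<and> card I = 2 * k.
        \<Sum>J | J \<subseteq> ?U \<and> card J = 2 * k.
          of_int (shuffle_sign (?U - I) I) * of_int (shuffle_sign (?U - J) J)
          * det (submatrix a (?U - I) (?U - J))
          * pfaffian (submatrix (b_array n X) I I)
          * pfaffian (submatrix (c_array n X) J J))"
    by (intro sum.cong refl term_eq) auto
  finally show ?thesis .
qed

end
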